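(* Let $(Q,S,\mu)$ be a skill multimap such that $\mu(t)$ is a finite set for each $t\in Q$, let $p:2^S\to 2^Q$ be the problem function induced by $(Q,S,\mu)$, and let $(Q,\mathscr{H})$ be the knowledge structure delineated by $(Q,S,\mu)$. Then $(Q,\mathscr{H})$ is a knowledge space if and only if the following holds: for every $H\subseteq Q$, one has $H\in\mathscr{H}$ if and only if there is $\mathcal{P}_H\subseteq\bigcup_{t\in Q}\mu_M(t)$ such that $H=\bigcup_{D\in\mathcal{P}_H}p(D)$.
   Context: A skill multimap is a triple $(Q,S,\mu)$ where $Q$ and $S$ are non-empty sets (of items and skills) and $\mu:Q\to 2^{2^S\setminus\{\emptyset\}}\setminus\{\emptyset\}$ is a mapping; so each $\mu(t)$ is a non-empty family of non-empty subsets of $S$, called competencies for $t$. For $t\in Q$, $\mu_M(t)$ denotes the set of elements of $\mu(t)$ that are minimal with respect to inclusion. The problem function induced by $(Q,S,\mu)$ is $p:2^S\to 2^Q$, $p(R)=\{g\in Q:\ \text{there exists } R_g\in\mu(g)\text{ with }R_g\subseteq R\}$. The knowledge structure delineated by $(Q,S,\mu)$ is $(Q,\mathscr{H})$ with $\mathscr{H}=\{p(R): R\in 2^S\}$. A knowledge structure $(Q,\mathscr{H})$ is a non-empty set $Q$ with a family $\mathscr{H}\subseteq 2^Q$ containing $\emptyset$ and $Q$; it is a knowledge space if $\bigcup\mathscr{H}'\in\mathscr{H}$ for every $\mathscr{H}'\subseteq\mathscr{H}$. The union of the empty family is $\emptyset$. *)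

theory Defs
  imports Main "HOL-Library.FuncSet"
begin

text \<open>
  Items and skills are carrier sets \<open>Q\<close> and \<open>S\<close>. Functions on \<open>Q\<close> or on the power set of \<open>S\<close>
  are HOL functions whose values outside these domains are irrelevant: \<open>\<mu>\<close> is only evaluated
  on \<open>Q\<close>, and the problem function only on subsets of \<open>S\<close>.
\<close>

definition skill_multimap :: "'q set \<Rightarrow> 's set \<Rightarrow> ('q \<Rightarrow> 's set set) \<Rightarrow> bool" where
  "skill_multimap Q S \<mu> \<longleftrightarrow>
     Q \<noteq> {} \<and> S \<noteq> {} \<and> \<mu> \<in> Q \<rightarrow> Pow (Pow S - {{}}) - {{}}"

definition minimal_competencies :: "('q \<Rightarrow> 's set set) \<Rightarrow> 'q \<Rightarrow> 's set set" where
  "minimal_competencies \<mu> t = {C \<in> \<mu> t. \<not> (\<exists>C' \<in> \<mu> t. C' \<subset> C)}"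

definition problem_function :: "'q set \<Rightarrow> ('q \<Rightarrow> 's set set) \<Rightarrow> 's set \<Rightarrow> 'q set" where
  "problem_function Q \<mu> R = {g \<in> Q. \<exists>C \<in> \<mu> g. C \<subseteq> R}"

definition delineated :: "'q set \<Rightarrow> 's set \<Rightarrow> ('q \<Rightarrow> 's set set) \<Rightarrow> 'q set set" where
  "delineated Q S \<mu> = problem_function Q \<mu> ` Pow S"

definition knowledge_structure :: "'q set \<Rightarrow> 'q set set \<Rightarrow> bool" where
  "knowledge_structure Q \<H> \<longleftrightarrow> Q \<noteq> {} \<and> \<H> \<subseteq> Pow Q \<and> {} \<in> \<H> \<and> Q \<in> \<H>"

definition knowledge_space :: "'q set \<Rightarrow> 'q set set \<Rightarrow> bool" where
  "knowledge_space Q \<H> \<longleftrightarrow>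
     knowledge_structure Q \<H> \<and> (\<forall>\<F>. \<F> \<subseteq> \<H> \<longrightarrow> \<Union>\<F> \<in> \<H>)"

end

theory Submission
  imports Defs
begin

text \<open>Since each \<open>\<mu> t\<close> is finite, every competency contains a minimal one.
  Hence \<open>p R\<close> is the union of the sets \<open>p D\<close> over the minimal competencies
  \<open>D\<close> inside \<open>R\<close> (\<open>problem_function_eq_Union_minimal\<close>), so
  every state is a union of such sets. Each \<open>p D\<close> is itself a state, so in a knowledge
  space all these unions are states, which gives the characterization. Conversely, the
  characterization says that the states are exactly the unions of sets \<open>p D\<close>, and a
  union of such unions is again one.\<close>

lemma problem_function_mono: "R \<subseteq> R' \<Longrightarrow> problem_function Q \<mu> R \<subseteq> problem_function Q \<mu> R'"
  by (auto simp: problem_function_def)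

text \<open>Finiteness of \<open>\<mu> t\<close> enters here: it excludes an infinite strictly
  descending chain of competencies below \<open>C\<close>.\<close>

lemma minimal_competencies_below:
  assumes "finite (\<mu> t)" and "C \<in> \<mu> t"
  obtains D where "D \<in> minimal_competencies \<mu> t" and "D \<subseteq> C"
  using finite_has_minimal2[OF assms] unfolding minimal_competencies_def by blast

text \<open>The empty skill set solves nothing because no competency is empty. The full set
  \<open>S\<close> solves everything because each item has some competency, and it lies inside
  \<open>S\<close>.\<close>

lemma knowledge_structure_delineated:
  assumes "skill_multimap Q S \<mu>"
  shows "knowledge_structure Q (delineated Q S \<mu>)"
proof -
  have \<mu>: "\<mu> t \<noteq> {} \<and> \<mu> t \<subseteq> Pow S \<and> {} \<notin> \<mu> t" if "t \<in> Q" for t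
    using assms that by (auto simp: skill_multimap_def Pi_iff)
  have "problem_function Q \<mu> {} = {}"
    using \<mu> by (simp add: problem_function_def)
  moreover have "problem_function Q \<mu> S = Q"
  proof (intro equalityI subsetI)
    fix t assume t: "t \<in> Q"
    then obtain C where "C \<in> \<mu> t"
      using \<mu> by blast
    then show "t \<in> problem_function Q \<mu> S"
      using t \<mu>[OF t] by (auto simp: problem_function_def)
  qed (simp add: problem_function_def)
  ultimately have "{} \<in> delineated Q S \<mu>" and "Q \<in> delineated Q S \<mu>"
    unfolding delineated_def by (simp_all add: rev_image_eqI[OF Pow_bottom] rev_image_eqI[OF Pow_top])
  moreover have "delineated Q S \<mu> \<subseteq> Pow Q"
    by (auto simp: delineated_def problem_function_def)
  moreover have "Q \<noteq> {}"
    using assms by (simp add: skill_multimap_def)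
  ultimately show ?thesis
    by (simp add: knowledge_structure_def)
qed

text \<open>If \<open>C \<subseteq> R\<close> is a competency for \<open>g\<close>, a minimal
  \<open>D \<subseteq> C\<close> for the same \<open>g\<close> already solves \<open>g\<close> and
  still lies in \<open>R\<close>. The other inclusion is monotonicity.\<close>

lemma problem_function_eq_Union_minimal:
  assumes "\<And>t. t \<in> Q \<Longrightarrow> finite (\<mu> t)"
  shows "problem_function Q \<mu> R =
    (\<Union>D \<in> {D \<in> \<Union>t\<in>Q. minimal_competencies \<mu> t. D \<subseteq> R}. problem_function Q \<mu> D)"
    (is "_ = ?U")
proof
  show "problem_function Q \<mu> R \<subseteq> ?U"
  proof
    fix g assume "g \<in> problem_function Q \<mu> R"
    then obtain C where C: "g \<in> Q" "C \<in> \<mu> g" "C \<subseteq> R"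
      by (auto simp: problem_function_def)
    then obtain D where D: "D \<in> minimal_competencies \<mu> g" "D \<subseteq> C"
      using minimal_competencies_below assms by metis
    then have "g \<in> problem_function Q \<mu> D"
      using C(1) by (auto simp: problem_function_def minimal_competencies_def)
    then show "g \<in> ?U"
      using C D by blast
  qed
  show "?U \<subseteq> problem_function Q \<mu> R"
    using problem_function_mono by fast
qed

theorem theorem35:
  fixes Q :: "'q set" and S :: "'s set" and \<mu> :: "'q \<Rightarrow> 's set set"
    and p :: "'s set \<Rightarrow> 'q set" and \<H> :: "'q set set"
  assumes "skill_multimap Q S \<mu>"
    and "\<And>t. t \<in> Q \<Longrightarrow> finite (\<mu> t)"
    and "p = problem_function Q \<mu>"
    and "\<H> = delineated Q S \<mu>"
  shows "knowledge_space Q \<H> \<longleftrightarrow>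
    (\<forall>H. H \<subseteq> Q \<longrightarrow>
      (H \<in> \<H> \<longleftrightarrow>
        (\<exists>P. P \<subseteq> (\<Union>t\<in>Q. minimal_competencies \<mu> t) \<and> H = (\<Union>D\<in>P. p D))))"
proof -
  let ?M = "\<Union>t\<in>Q. minimal_competencies \<mu> t"
  show ?thesis
  proof
    assume space: "knowledge_space Q \<H>"
    have "?M \<subseteq> Pow S"
      using assms(1) by (auto simp: skill_multimap_def minimal_competencies_def Pi_iff)
    then have p_M: "p ` ?M \<subseteq> \<H>"
      unfolding assms(3,4) delineated_def by (rule image_mono)
    show "\<forall>H. H \<subseteq> Q \<longrightarrow> (H \<in> \<H> \<longleftrightarrow> (\<exists>P. P \<subseteq> ?M \<and> H = (\<Union>D\<in>P. p D)))"
    proof (intro allI impI iffI)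
      fix H assume "H \<in> \<H>"
      then obtain R where "H = p R"
        by (auto simp: assms(3,4) delineated_def)
      then have "H = (\<Union>D \<in> {D \<in> ?M. D \<subseteq> R}. p D)"
        using problem_function_eq_Union_minimal[of Q \<mu> R] assms(2,3) by simp
      then show "\<exists>P. P \<subseteq> ?M \<and> H = (\<Union>D\<in>P. p D)"
        by (intro exI[of _ "{D \<in> ?M. D \<subseteq> R}"] conjI) auto
    next
      fix H assume "\<exists>P. P \<subseteq> ?M \<and> H = (\<Union>D\<in>P. p D)"
      then obtain P where P: "P \<subseteq> ?M" "H = \<Union>(p ` P)"
        by blast
      \<comment> \<open>The sets \<open>p D\<close> for \<open>D\<close> in \<open>P\<close> form
        the family of states to which closure under unions is applied.\<close>
      then have "p ` P \<subseteq> \<H>"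
        using p_M by blast
      then show "H \<in> \<H>"
        using space P(2) unfolding knowledge_space_def by blast
    qed
  next
    assume char: "\<forall>H. H \<subseteq> Q \<longrightarrow> (H \<in> \<H> \<longleftrightarrow> (\<exists>P. P \<subseteq> ?M \<and> H = (\<Union>D\<in>P. p D)))"
    have struct: "knowledge_structure Q \<H>"
      using knowledge_structure_delineated assms(1,4) by simp
    then have sub: "\<H> \<subseteq> Pow Q"
      by (simp add: knowledge_structure_def)
    have "\<Union>\<F> \<in> \<H>" if \<F>: "\<F> \<subseteq> \<H>" for \<F>
    proof -
      \<comment> \<open>Taking every admissible \<open>D\<close> at once avoids choosing a
        representing family for each member of \<open>\<F>\<close>. The inclusion of the resulting
        union in \<open>\<Union>\<F>\<close> is then immediate.\<close>
      let ?P = "{D \<in> ?M. p D \<subseteq> \<Union>\<F>}"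
      have "\<Union>\<F> \<subseteq> (\<Union>D\<in>?P. p D)"
      proof (rule Union_least)
        fix K assume K: "K \<in> \<F>"
        then obtain P where P: "P \<subseteq> ?M" "K = (\<Union>D\<in>P. p D)"
          using char \<F> sub by (meson PowD subsetD)
        \<comment> \<open>Each \<open>D\<close> in \<open>P\<close> satisfies
          \<open>p D \<subseteq> K \<subseteq> \<Union>\<F>\<close>.\<close>
        then have "P \<subseteq> ?P"
          using K by blast
        then show "K \<subseteq> (\<Union>D\<in>?P. p D)"
          unfolding P(2) by (rule UN_mono) simp
      qed
      then have "\<Union>\<F> = (\<Union>D\<in>?P. p D)"
        by (intro equalityI UN_least) auto
      moreover have "\<Union>\<F> \<subseteq> Q"
        using \<F> sub by blast
      moreover have "?P \<subseteq> ?M"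
        by blast
      ultimately show ?thesis
        using char[rule_format, of "\<Union>\<F>", THEN iffD2, OF _ exI[of _ ?P]] by simp
    qed
    then show "knowledge_space Q \<H>"
      using struct by (simp add: knowledge_space_def)
  qed
qed

end
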